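(* Let $\varphi_{\mathbb C}(z)=z+\sqrt{1+z^2}$ (principal branch of the square root) and $\varphi_e(z)=e^z$ for $z\in\mathbb D$. Then the sharp $\mathcal S^*(\varphi_{\mathbb C})$-radius of $\mathcal S^*(\varphi_e)$ is $$R_{\mathcal S^*(\varphi_{\mathbb C})}(\mathcal S^*(\varphi_e))=\operatorname{arsinh}1=\log(1+\sqrt2).$$
   Context: Let $\mathbb D=\{z\in\mathbb C:|z|<1\}$ and let $\mathcal A$ be the class of functions $f$ analytic on $\mathbb D$ with $f(0)=0$ and $f'(0)=1$. For an analytic function $\varphi$ on $\mathbb D$ with $\varphi(0)=1$, the class $\mathcal S^*(\varphi)$ consists of all $f\in\mathcal A$ with $zf'(z)/f(z)\prec\varphi(z)$; that is, there is an analytic $\omega:\mathbb D\to\mathbb D$ with $\omega(0)=0$ such that $zf'(z)/f(z)=\varphi(\omega(z))$ on $\mathbb D$ (the quotient takes the value $1$ at $z=0$, and $f$ has no other zeros). For two such functions $\varphi_1,\varphi_2$, the sharp $\mathcal S^*(\varphi_2)$-radius of $\mathcal S^*(\varphi_1)$ is $$R_{\mathcal S^*(\varphi_2)}(\mathcal S^*(\varphi_1))=\sup\left\{r\in(0,1]: f_r(z)=\tfrac{f(rz)}{r}\text{ belongs to }\mathcal S^*(\varphi_2)\text{ for every } f\in\mathcal S^*(\varphi_1)\right\}.$$ *)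

theory Defs
  imports "HOL-Complex_Analysis.Complex_Analysis"
begin

definition class_A :: "(complex \<Rightarrow> complex) set" where
  "class_A = {f. f analytic_on ball 0 1 \<and> f 0 = 0 \<and> deriv f 0 = 1}"

definition subordinate :: "(complex \<Rightarrow> complex) \<Rightarrow> (complex \<Rightarrow> complex) \<Rightarrow> bool" where
  "subordinate g \<phi> \<longleftrightarrow>
     (\<exists>\<omega>. \<omega> analytic_on ball 0 1 \<and> \<omega> \<in> ball 0 1 \<rightarrow> ball 0 1 \<and> \<omega> 0 = 0 \<and>
          (\<forall>z\<in>ball 0 1. g z = \<phi> (\<omega> z)))"

text \<open>For \<open>f\<close> in \<open>class_A\<close> the singularity of \<open>z f'(z) / f(z)\<close> at \<open>0\<close> is removable with value \<open>1\<close>.\<close>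

definition starlike_quotient :: "(complex \<Rightarrow> complex) \<Rightarrow> complex \<Rightarrow> complex" where
  "starlike_quotient f z = (if z = 0 then 1 else z * deriv f z / f z)"

text \<open>Since division by zero is total in HOL, the absence of zeros of \<open>f\<close> other than \<open>0\<close>,
  implicit in the requirement that the quotient be analytic, is demanded explicitly.\<close>

definition starlike_class :: "(complex \<Rightarrow> complex) \<Rightarrow> (complex \<Rightarrow> complex) set" where
  "starlike_class \<phi> =
     {f \<in> class_A. (\<forall>z\<in>ball 0 1 - {0}. f z \<noteq> 0) \<and> subordinate (starlike_quotient f) \<phi>}"

text \<open>The set below is bounded by \<open>1\<close>; the real supremum is meaningful whenever the set is nonempty.\<close>

definition starlike_radius :: "(complex \<Rightarrow> complex) \<Rightarrow> (complex \<Rightarrow> complex) \<Rightarrow> real" where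
  "starlike_radius \<phi>2 \<phi>1 =
     Sup {r \<in> {0<..1}. \<forall>f\<in>starlike_class \<phi>1.
            (\<lambda>z. f (complex_of_real r * z) / complex_of_real r) \<in> starlike_class \<phi>2}"

definition phi_crescent :: "complex \<Rightarrow> complex" where
  "phi_crescent z = z + csqrt (1 + z\<^sup>2)"

definition phi_exp :: "complex \<Rightarrow> complex" where
  "phi_exp z = exp z"

end

theory Submission imports Defs begin

text \<open>
  The function \<open>phi_crescent\<close> inverts \<open>w \<mapsto> (w - 1 / w) / 2\<close>, so that
  \<open>phi_crescent (sinh u) = exp u\<close> whenever \<open>\<bar>Im u\<bar> < pi / 2\<close>, and conversely
  \<open>phi_crescent w = exp u\<close> forces \<open>w = sinh u\<close>.  If \<open>z f'(z) / f(z) = exp (\<omega> z)\<close>, the Schwarz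
  lemma gives \<open>norm (sinh (\<omega> (r z))) \<le> sinh (r * norm z) < 1\<close> for \<open>r = arsinh 1\<close>, and
  \<open>z \<mapsto> sinh (\<omega> (r z))\<close> is the required Schwarz function.  For larger \<open>r\<close>, the function with
  quotient \<open>exp z\<close> would need a Schwarz function equal to \<open>sinh (r z)\<close>, which takes the value \<open>1\<close>
  at \<open>z = arsinh 1 / r\<close>.
\<close>

text \<open>All Taylor coefficients of \<open>sinh\<close> at 0 are nonnegative, so its series at
  \<open>z\<close> is dominated term by term by its series at \<open>norm z\<close>.\<close>

lemma norm_sinh_le:
  fixes z :: "'a :: {banach, real_normed_field}"
  shows "norm (sinh z) \<le> sinh (norm z)"
  by (rule norm_sums_le[OF sinh_converges sinh_converges]) (auto simp: norm_power)

text \<open>Since \<open>1 + (sinh u)\<^sup>2 = (cosh u)\<^sup>2\<close>, the only question is which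
  root \<open>csqrt\<close> picks. In this strip \<open>cosh u\<close> has positive real part, so it
  is the principal one.\<close>

lemma phi_crescent_sinh:
  assumes "\<bar>Im u\<bar> < pi / 2"
  shows "phi_crescent (sinh u) = exp u"
proof -
  have "Re (cosh u) = (exp (Re u) + exp (- Re u)) * cos (Im u) / 2"
    by (simp add: cosh_field_def Re_exp algebra_simps)
  moreover have "cos (Im u) > 0"
    using assms by (intro cos_gt_zero_pi) auto
  ultimately have "Re (cosh u) > 0"
    by (simp only:) (intro divide_pos_pos mult_pos_pos add_pos_pos; simp)
  hence "csqrt ((cosh u)\<^sup>2) = cosh u"
    by (intro csqrt_square) auto
  thus ?thesis
    by (simp add: phi_crescent_def cosh_square_eq cosh_plus_sinh add.commute)
qed

text \<open>Squaring removes the root and \<open>w\<^sup>2\<close> cancels, which leaves an equation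
  linear in \<open>w\<close>. Hence the conclusion holds for every \<open>u\<close>, outside the
  strip as well.\<close>

lemma sinh_if_phi_crescent:
  assumes "phi_crescent w = exp u"
  shows "w = sinh u"
proof -
  have "csqrt (1 + w\<^sup>2) = exp u - w"
    using assms by (simp add: phi_crescent_def algebra_simps)
  hence "1 + w\<^sup>2 = (exp u - w)\<^sup>2"
    by (metis power2_csqrt)
  hence "exp u * (exp u - 2 * w) = 1"
    by (simp add: power2_eq_square algebra_simps)
  hence "exp (-u) = exp u - 2 * w"
    by (simp add: exp_minus inverse_unique)
  thus ?thesis
    by (simp add: sinh_field_def)
qed

lemma scaled_in_unit_ball:
  assumes "r \<in> {0<..1::real}" "z \<in> ball 0 1"
  shows "complex_of_real r * z \<in> ball 0 1"
  using assms mult_left_le_one_le[of "norm z" r] by (auto simp: norm_mult)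

lemma analytic_on_scaled:
  assumes "f analytic_on ball 0 1" "r \<in> {0<..1::real}"
  shows "(\<lambda>z. f (complex_of_real r * z)) analytic_on ball 0 1"
proof -
  have "(\<lambda>z. complex_of_real r * z) analytic_on ball 0 1"
    by (intro analytic_intros)
  from analytic_on_compose_gen[OF this assms(1)] show ?thesis
    using scaled_in_unit_ball[OF assms(2)] by (auto simp: o_def)
qed

lemma deriv_scaled:
  assumes "f analytic_on ball 0 1" "r \<in> {0<..1::real}" "z \<in> ball 0 1"
  shows "deriv (\<lambda>z. f (of_real r * z) / of_real r) z = deriv f (of_real r * z)"
proof -
  have "(f has_field_derivative deriv f (of_real r * z)) (at (of_real r * z))"
    using assms(1) scaled_in_unit_ball[OF assms(2,3)]
    by (simp add: analytic_on_imp_differentiable_at DERIV_deriv_iff_field_differentiable)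
  hence "((\<lambda>z. f (of_real r * z)) has_field_derivative
           deriv f (of_real r * z) * of_real r) (at z)"
    by (rule DERIV_chain2) (auto intro!: derivative_eq_intros)
  hence "((\<lambda>z. f (of_real r * z) / of_real r) has_field_derivative
           deriv f (of_real r * z) * of_real r / of_real r) (at z)"
    by (rule DERIV_cdivide)
  thus ?thesis
    using assms(2) by (simp add: DERIV_imp_deriv)
qed

lemma class_A_scaled:
  assumes "f \<in> class_A" "r \<in> {0<..1::real}"
  shows "(\<lambda>z. f (of_real r * z) / of_real r) \<in> class_A"
  using assms deriv_scaled[of f r 0] analytic_on_scaled[of f r]
  by (auto simp: class_A_def intro!: analytic_intros)

text \<open>The chain-rule factor \<open>r\<close> cancels in the derivative, while dividing
  \<open>f (r * z)\<close> by \<open>r\<close> supplies the factor that turns the leading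
  \<open>z\<close> into \<open>r * z\<close>.\<close>

lemma starlike_quotient_scaled:
  assumes "f \<in> class_A" "r \<in> {0<..1::real}" "z \<in> ball 0 1"
  shows "starlike_quotient (\<lambda>z. f (of_real r * z) / of_real r) z
           = starlike_quotient f (of_real r * z)"
  using assms deriv_scaled[of f r z] by (auto simp: starlike_quotient_def class_A_def)

lemma scaled_in_starlike_crescent:
  assumes f: "f \<in> starlike_class phi_exp" and r: "r \<in> {0<..1}" "r \<le> arsinh 1"
  shows "(\<lambda>z. f (of_real r * z) / of_real r) \<in> starlike_class phi_crescent"
proof -
  from f have fA: "f \<in> class_A" and fnz: "\<And>z. z \<in> ball 0 1 - {0} \<Longrightarrow> f z \<noteq> 0"
    by (auto simp: starlike_class_def)
  from f obtain w where w: "w analytic_on ball 0 1" "w \<in> ball 0 1 \<rightarrow> ball 0 1" "w 0 = 0"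
      "\<And>z. z \<in> ball 0 1 \<Longrightarrow> starlike_quotient f z = exp (w z)"
    by (auto simp: starlike_class_def subordinate_def phi_exp_def)
  have bound: "norm (w (of_real r * z)) < r" if z: "z \<in> ball 0 1" for z
  proof -
    have "norm (w (of_real r * z)) \<le> norm (of_real r * z)"
      using w(2) scaled_in_unit_ball[OF r(1) z]
      by (intro Schwarz_Lemma(1)[OF analytic_imp_holomorphic[OF w(1)] w(3)]) auto
    also have "\<dots> < r"
      using r(1) z by (simp add: norm_mult)
    finally show ?thesis .
  qed
  define v where "v = (\<lambda>z. sinh (w (of_real r * z)))"
  have "v analytic_on ball 0 1"
    unfolding v_def sinh_field_def
    by (intro analytic_intros analytic_on_scaled w(1) r(1)) auto
  moreover have "v \<in> ball 0 1 \<rightarrow> ball 0 1"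
  proof
    fix z :: complex assume "z \<in> ball 0 1"
    hence "sinh (norm (w (of_real r * z))) < sinh (arsinh 1)"
      using bound[of z] r(2) unfolding sinh_real_less_iff by linarith
    thus "v z \<in> ball 0 1"
      using norm_sinh_le[of "w (of_real r * z)"] by (simp add: v_def)
  qed
  moreover have "starlike_quotient (\<lambda>z. f (of_real r * z) / of_real r) z = phi_crescent (v z)"
    if z: "z \<in> ball 0 1" for z
  proof -
    \<comment> \<open>The imaginary part is at most the norm, which is below
      \<open>r \<le> 1 < pi / 2\<close>; this is the strip where the root is the principal
      one.\<close>
    have "\<bar>Im (w (of_real r * z))\<bar> < pi / 2"
      using abs_Im_le_cmod[of "w (of_real r * z)"] bound[OF z] r(1) pi_gt3 by auto
    thus ?thesis
      using starlike_quotient_scaled[OF fA r(1) z] w(4)[OF scaled_in_unit_ball[OF r(1) z]]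
      by (simp add: v_def phi_crescent_sinh)
  qed
  ultimately have "subordinate (starlike_quotient (\<lambda>z. f (of_real r * z) / of_real r)) phi_crescent"
    using w(3) unfolding subordinate_def by (intro exI[of _ v]) (simp add: v_def)
  moreover have "f (of_real r * z) / of_real r \<noteq> 0" if "z \<in> ball 0 1 - {0}" for z
    using that fnz[of "of_real r * z"] scaled_in_unit_ball[OF r(1), of z] r(1) by simp
  ultimately show ?thesis
    using class_A_scaled[OF fA r(1)] by (simp add: starlike_class_def)
qed

text \<open>Integrating \<open>f' / f = exp z / z\<close> gives \<open>f z = z * exp (g z)\<close>,
  where \<open>g\<close> is the primitive of \<open>(exp z - 1) / z\<close> vanishing at 0. The
  exponential factor excludes further zeros.\<close>

lemma starlike_exp_extremal:
  obtains f where "f \<in> starlike_class phi_exp"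
    and "\<And>z. z \<in> ball 0 1 \<Longrightarrow> starlike_quotient f z = exp z"
proof -
  define h where "h = (\<lambda>z::complex. if z = 0 then 1 else (exp z - 1) / z)"
  \<comment> \<open>This derivative is the value that removes the singularity of
    \<open>(exp z - 1) / z\<close> at 0.\<close>
  have "deriv (\<lambda>z::complex. exp z - 1) 0 = 1"
    by (rule DERIV_imp_deriv) (auto intro!: derivative_eq_intros)
  hence "h holomorphic_on ball 0 1"
    by (intro pole_theorem_open_0[of "\<lambda>z. exp z - 1" "ball 0 1" 0 h])
       (auto simp: h_def intro!: holomorphic_intros)
  then obtain g0 where "\<And>z. z \<in> ball 0 1 \<Longrightarrow> (g0 has_field_derivative h z) (at z within ball 0 1)"
    using holomorphic_convex_primitive'[of "ball 0 1" h] by auto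
  hence g0: "(g0 has_field_derivative h z) (at z)" if "z \<in> ball 0 1" for z
    using that by (metis at_within_open open_ball)
  \<comment> \<open>The normalisation \<open>g 0 = 0\<close> yields
    \<open>deriv f 0 = exp (g 0) = 1\<close>.\<close>
  define g where "g = (\<lambda>z. g0 z - g0 0)"
  have g: "(g has_field_derivative h z) (at z)" if "z \<in> ball 0 1" for z
    unfolding g_def using g0[OF that] by (auto intro!: derivative_eq_intros)
  define f where "f = (\<lambda>z. z * exp (g z))"
  have f: "(f has_field_derivative exp z * exp (g z)) (at z)" if "z \<in> ball 0 1" for z
  proof -
    \<comment> \<open>The product rule gives the derivative of \<open>f\<close> as
      \<open>(1 + z * h z) * exp (g z)\<close>; this identity, valid also at 0, turns it into the
      stated form.\<close>
    have "exp z = 1 + z * h z"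
      by (simp add: h_def)
    hence "exp z * exp (g z) = exp (g z) + z * h z * exp (g z)"
      by (simp only: distrib_right mult_1)
    thus ?thesis
      unfolding f_def using g[OF that] by (auto intro!: derivative_eq_intros simp: algebra_simps)
  qed
  have quot: "starlike_quotient f z = exp z" if "z \<in> ball 0 1" for z
    using DERIV_imp_deriv[OF f[OF that]] by (simp add: starlike_quotient_def f_def)
  have "f analytic_on ball 0 1"
    using f by (metis analytic_on_open holomorphic_on_open open_ball)
  moreover have "deriv f 0 = 1"
    using DERIV_imp_deriv[OF f[of 0]] by (simp add: g_def)
  ultimately have "f \<in> class_A"
    by (simp add: class_A_def f_def)
  moreover have "subordinate (starlike_quotient f) phi_exp"
    unfolding subordinate_def phi_exp_def
    by (rule exI[of _ "\<lambda>z. z"]) (auto simp: quot)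
  ultimately have "f \<in> starlike_class phi_exp"
    by (auto simp: starlike_class_def f_def)
  with quot show ?thesis
    using that by blast
qed

lemma starlike_crescent_radius_le:
  assumes r: "r \<in> {0<..1}"
    and sub: "\<And>f. f \<in> starlike_class phi_exp \<Longrightarrow>
                (\<lambda>z. f (of_real r * z) / of_real r) \<in> starlike_class phi_crescent"
  shows "r \<le> arsinh 1"
proof (rule ccontr)
  assume "\<not> r \<le> arsinh 1"
  \<comment> \<open>This point lies in the open disc exactly because \<open>arsinh 1 < r\<close>.
    There the Schwarz function is forced to have the boundary value
    \<open>sinh (arsinh 1) = 1\<close>.\<close>
  define z where "z = complex_of_real (arsinh 1 / r)"
  have z: "z \<in> ball 0 1" and rz: "of_real r * z = of_real (arsinh 1)"
    using r \<open>\<not> r \<le> arsinh 1\<close> arsinh_real_pos_iff[of 1]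
    by (auto simp: z_def norm_divide simp del: arsinh_real_pos_iff)
  obtain f where f: "f \<in> starlike_class phi_exp"
      and quot: "\<And>z. z \<in> ball 0 1 \<Longrightarrow> starlike_quotient f z = exp z"
    by (rule starlike_exp_extremal) blast
  obtain w where w: "w \<in> ball 0 1 \<rightarrow> ball 0 1"
      "\<And>z. z \<in> ball 0 1 \<Longrightarrow>
         starlike_quotient (\<lambda>z. f (of_real r * z) / of_real r) z = phi_crescent (w z)"
    using sub[OF f] by (auto simp: starlike_class_def subordinate_def)
  have "phi_crescent (w z) = exp (of_real r * z)"
    using w(2)[OF z] starlike_quotient_scaled[OF _ r z, of f] f
      quot[OF scaled_in_unit_ball[OF r z]] by (simp add: starlike_class_def)
  hence "w z = sinh (of_real (arsinh 1))"
    unfolding rz by (rule sinh_if_phi_crescent)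
  also have "\<dots> = of_real (sinh (arsinh 1))"
    by (simp add: sinh_field_def exp_of_real flip: of_real_minus)
  finally have "norm (w z) = 1"
    by simp
  thus False
    using funcset_mem[OF w(1) z] by simp
qed

text \<open>Places \<open>arsinh 1\<close> among the radii over which the supremum runs. It follows
  from \<open>x \<le> sinh x\<close> at \<open>x = 1\<close> and the monotonicity of
  \<open>sinh\<close>.\<close>

lemma arsinh_1_le_1: "arsinh 1 \<le> (1::real)"
proof -
  have "1 \<le> sinh (1::real)"
    using real_le_x_sinh[of 1] by (simp add: sinh_field_def exp_minus)
  hence "sinh (arsinh 1) \<le> sinh (1::real)"
    by simp
  thus ?thesis
    unfolding sinh_real_le_iff .
qed

theorem theorem8p2:
  "starlike_radius phi_crescent phi_exp = arsinh (1::real) \<and> arsinh (1::real) = ln (1 + sqrt 2)"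
proof
  have "arsinh 1 \<in> {0<..1::real}"
    using arsinh_1_le_1 by simp
  \<comment> \<open>The supremum is a maximum: \<open>arsinh 1\<close> is itself admissible and
    bounds every admissible radius.\<close>
  thus "starlike_radius phi_crescent phi_exp = arsinh 1"
    unfolding starlike_radius_def
    by (intro cSup_eq_maximum) (auto intro: scaled_in_starlike_crescent starlike_crescent_radius_le)
  show "arsinh (1::real) = ln (1 + sqrt 2)"
    by (simp add: arsinh_real_def)
qed

end
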